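(* Every tame refinement monoid $M$ is separative, is unperforated, and satisfies the Riesz interpolation property.
   Context: All monoids are commutative, written additively, and homomorphisms are monoid homomorphisms. $\mathbb{N}$ denotes the positive integers. The algebraic ordering on a monoid $M$ is the translation-invariant pre-order: $x\le y$ iff $x+z=y$ for some $z\in M$. $M$ is a refinement monoid if whenever $x_1+x_2=y_1+y_2$ in $M$, there exist $z_{ij}\in M$ ($i,j=1,2$) with $x_i=z_{i1}+z_{i2}$ for $i=1,2$ and $y_j=z_{1j}+z_{2j}$ for $j=1,2$. A refinement monoid is tame if it is an inductive (directed) limit, in the category of commutative monoids, of an inductive system of finitely generated refinement monoids; otherwise it is wild. $M$ is separative if $2x=2y=x+y$ implies $x=y$ for all $x,y\in M$. $M$ is unperforated if $mx\le my$ implies $x\le y$ for all $m\in\mathbb{N}$, $x,y\in M$. $M$ satisfies the Riesz interpolation property if whenever $x_1,x_2,y_1,y_2\in M$ with $x_i\le y_j$ for all $i,j\in\{1,2\}$, there is $z\in M$ with $x_i\le z\le y_j$ for all $i,j\in\{1,2\}$. *)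

theory Defs
  imports "HOL-Algebra.Group"
begin

text \<open>
  Commutative monoids are the structures \<open>M\<close> with \<open>comm_monoid M\<close> from HOL-Algebra, whose notation is
  multiplicative: \<open>x \<otimes> y\<close>, \<open>\<one>\<close> and \<open>x [^] m\<close> stand for the additive \<open>x + y\<close>, \<open>0\<close> and \<open>m x\<close>.
\<close>

text \<open>The library's \<open>hom\<close> does not require preservation of the unit.\<close>

definition mon_hom :: "('a, 'm) monoid_scheme \<Rightarrow> ('b, 'n) monoid_scheme \<Rightarrow> ('a \<Rightarrow> 'b) set" where
  "mon_hom G H = {h \<in> hom G H. h \<one>\<^bsub>G\<^esub> = \<one>\<^bsub>H\<^esub>}"

definition alg_le :: "('a, 'm) monoid_scheme \<Rightarrow> 'a \<Rightarrow> 'a \<Rightarrow> bool" where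
  "alg_le M x y \<longleftrightarrow> (\<exists>z\<in>carrier M. x \<otimes>\<^bsub>M\<^esub> z = y)"

locale refinement_monoid = comm_monoid M for M (structure) +
  assumes refinement:
    "\<lbrakk>x1 \<in> carrier M; x2 \<in> carrier M; y1 \<in> carrier M; y2 \<in> carrier M; x1 \<otimes> x2 = y1 \<otimes> y2\<rbrakk>
      \<Longrightarrow> \<exists>z11\<in>carrier M. \<exists>z12\<in>carrier M. \<exists>z21\<in>carrier M. \<exists>z22\<in>carrier M.
            x1 = z11 \<otimes> z12 \<and> x2 = z21 \<otimes> z22 \<and> y1 = z11 \<otimes> z21 \<and> y2 = z12 \<otimes> z22"

definition separative :: "('a, 'm) monoid_scheme \<Rightarrow> bool" where
  "separative M \<longleftrightarrow> (\<forall>x\<in>carrier M. \<forall>y\<in>carrier M.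
     x \<otimes>\<^bsub>M\<^esub> x = y \<otimes>\<^bsub>M\<^esub> y \<and> y \<otimes>\<^bsub>M\<^esub> y = x \<otimes>\<^bsub>M\<^esub> y \<longrightarrow> x = y)"

definition unperforated :: "('a, 'm) monoid_scheme \<Rightarrow> bool" where
  "unperforated M \<longleftrightarrow> (\<forall>m::nat. \<forall>x\<in>carrier M. \<forall>y\<in>carrier M.
     m \<ge> 1 \<and> alg_le M (x [^]\<^bsub>M\<^esub> m) (y [^]\<^bsub>M\<^esub> m) \<longrightarrow> alg_le M x y)"

definition riesz_interpolation :: "('a, 'm) monoid_scheme \<Rightarrow> bool" where
  "riesz_interpolation M \<longleftrightarrow>
     (\<forall>x1\<in>carrier M. \<forall>x2\<in>carrier M. \<forall>y1\<in>carrier M. \<forall>y2\<in>carrier M.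
        alg_le M x1 y1 \<and> alg_le M x1 y2 \<and> alg_le M x2 y1 \<and> alg_le M x2 y2 \<longrightarrow>
        (\<exists>z\<in>carrier M. alg_le M x1 z \<and> alg_le M x2 z \<and> alg_le M z y1 \<and> alg_le M z y2))"

definition finitely_generated_monoid :: "('a, 'm) monoid_scheme \<Rightarrow> bool" where
  "finitely_generated_monoid M \<longleftrightarrow>
     (\<exists>S. finite S \<and> S \<subseteq> carrier M \<and> (\<forall>H. submonoid H M \<and> S \<subseteq> H \<longrightarrow> H = carrier M))"

locale inductive_system =
  fixes I :: "'i set" and r :: "'i rel" and A :: "'i \<Rightarrow> 'b monoid" and \<phi> :: "'i \<Rightarrow> 'i \<Rightarrow> 'b \<Rightarrow> 'b"
  assumes preorder: "preorder_on I r"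
    and nonempty: "I \<noteq> {}"
    and directed: "\<lbrakk>i \<in> I; j \<in> I\<rbrakk> \<Longrightarrow> \<exists>k\<in>I. (i, k) \<in> r \<and> (j, k) \<in> r"
    and monoids: "i \<in> I \<Longrightarrow> comm_monoid (A i)"
    and trans_hom: "(i, j) \<in> r \<Longrightarrow> \<phi> i j \<in> mon_hom (A i) (A j)"
    and trans_id: "\<lbrakk>i \<in> I; x \<in> carrier (A i)\<rbrakk> \<Longrightarrow> \<phi> i i x = x"
    and trans_comp: "\<lbrakk>(i, j) \<in> r; (j, k) \<in> r; x \<in> carrier (A i)\<rbrakk> \<Longrightarrow> \<phi> j k (\<phi> i j x) = \<phi> i k x"

definition cocone ::
  "'i set \<Rightarrow> 'i rel \<Rightarrow> ('i \<Rightarrow> 'b monoid) \<Rightarrow> ('i \<Rightarrow> 'i \<Rightarrow> 'b \<Rightarrow> 'b) \<Rightarrow> 'c monoid \<Rightarrow> ('i \<Rightarrow> 'b \<Rightarrow> 'c) \<Rightarrow> bool"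
where
  "cocone I r A \<phi> T \<xi> \<longleftrightarrow> comm_monoid T \<and> (\<forall>i\<in>I. \<xi> i \<in> mon_hom (A i) T) \<and>
     (\<forall>(i, j)\<in>r. \<forall>x\<in>carrier (A i). \<xi> j (\<phi> i j x) = \<xi> i x)"

text \<open>
  The universal property of the cocone \<open>(M, \<psi>)\<close>, tested against the cocones whose vertex is a
  commutative monoid with carrier in the type \<open>'c\<close>.
\<close>

definition universal_cocone ::
  "'c itself \<Rightarrow> 'i set \<Rightarrow> 'i rel \<Rightarrow> ('i \<Rightarrow> 'b monoid) \<Rightarrow> ('i \<Rightarrow> 'i \<Rightarrow> 'b \<Rightarrow> 'b) \<Rightarrow>
     'a monoid \<Rightarrow> ('i \<Rightarrow> 'b \<Rightarrow> 'a) \<Rightarrow> bool"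
where
  "universal_cocone _ I r A \<phi> M \<psi> \<longleftrightarrow>
     (\<forall>(T :: 'c monoid) \<xi>. cocone I r A \<phi> T \<xi> \<longrightarrow>
        (\<exists>h\<in>mon_hom M T. (\<forall>i\<in>I. \<forall>x\<in>carrier (A i). h (\<psi> i x) = \<xi> i x) \<and>
           (\<forall>h'\<in>mon_hom M T. (\<forall>i\<in>I. \<forall>x\<in>carrier (A i). h' (\<psi> i x) = \<xi> i x) \<longrightarrow>
              (\<forall>x\<in>carrier M. h' x = h x))))"

text \<open>
  An inductive limit is a colimit in the category of commutative monoids.  A HOL definition cannot
  quantify over the types of the test monoids; it is enough to test against the type of \<open>M\<close> itself
  and against \<open>('i \<times> 'b) set\<close>, in which the quotient of the disjoint union of the \<open>A i\<close> lives:
  see \<open>inductive_limit_universal\<close> below, where the test type is arbitrary.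
\<close>

definition inductive_limit ::
  "'i set \<Rightarrow> 'i rel \<Rightarrow> ('i \<Rightarrow> 'b monoid) \<Rightarrow> ('i \<Rightarrow> 'i \<Rightarrow> 'b \<Rightarrow> 'b) \<Rightarrow>
     'a monoid \<Rightarrow> ('i \<Rightarrow> 'b \<Rightarrow> 'a) \<Rightarrow> bool"
where
  "inductive_limit I r A \<phi> M \<psi> \<longleftrightarrow>
     inductive_system I r A \<phi> \<and> cocone I r A \<phi> M \<psi> \<and>
     universal_cocone TYPE('a) I r A \<phi> M \<psi> \<and>
     universal_cocone TYPE(('i \<times> 'b) set) I r A \<phi> M \<psi>"

text \<open>
  The types \<open>'i\<close> of the indices and \<open>'b\<close> of the elements of the approximating monoids are parameters,
  again because a definition cannot quantify over them.  A theorem with a hypothesis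
  \<open>tame_refinement_monoid TYPE('i) TYPE('b) M\<close> for type variables \<open>'i\<close> and \<open>'b\<close> covers all of them.
\<close>

definition tame_refinement_monoid :: "'i itself \<Rightarrow> 'b itself \<Rightarrow> 'a monoid \<Rightarrow> bool" where
  "tame_refinement_monoid _ _ M \<longleftrightarrow> refinement_monoid M \<and>
     (\<exists>(I :: 'i set) r (A :: 'i \<Rightarrow> 'b monoid) \<phi> \<psi>.
        inductive_limit I r A \<phi> M \<psi> \<and>
        (\<forall>i\<in>I. refinement_monoid (A i) \<and> finitely_generated_monoid (A i)))"


lemma mon_homD:
  assumes "h \<in> mon_hom G H"
  shows "x \<in> carrier G \<Longrightarrow> h x \<in> carrier H"
    and "\<lbrakk>x \<in> carrier G; y \<in> carrier G\<rbrakk> \<Longrightarrow> h (x \<otimes>\<^bsub>G\<^esub> y) = h x \<otimes>\<^bsub>H\<^esub> h y"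
    and "h \<one>\<^bsub>G\<^esub> = \<one>\<^bsub>H\<^esub>"
  using assms by (auto simp: mon_hom_def hom_def)

lemma mon_homI:
  assumes "\<And>x. x \<in> carrier G \<Longrightarrow> h x \<in> carrier H"
    and "\<And>x y. \<lbrakk>x \<in> carrier G; y \<in> carrier G\<rbrakk> \<Longrightarrow> h (x \<otimes>\<^bsub>G\<^esub> y) = h x \<otimes>\<^bsub>H\<^esub> h y"
    and "h \<one>\<^bsub>G\<^esub> = \<one>\<^bsub>H\<^esub>"
  shows "h \<in> mon_hom G H"
  using assms by (auto simp: mon_hom_def hom_def)

lemma coconeD:
  assumes "cocone I r A \<phi> T \<xi>"
  shows "comm_monoid T" and "i \<in> I \<Longrightarrow> \<xi> i \<in> mon_hom (A i) T"
    and "\<lbrakk>(i, j) \<in> r; x \<in> carrier (A i)\<rbrakk> \<Longrightarrow> \<xi> j (\<phi> i j x) = \<xi> i x"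
  using assms unfolding cocone_def by fast+

lemma coconeI:
  assumes "comm_monoid T" and "\<And>i. i \<in> I \<Longrightarrow> \<xi> i \<in> mon_hom (A i) T"
    and "\<And>i j x. \<lbrakk>(i, j) \<in> r; x \<in> carrier (A i)\<rbrakk> \<Longrightarrow> \<xi> j (\<phi> i j x) = \<xi> i x"
  shows "cocone I r A \<phi> T \<xi>"
  using assms unfolding cocone_def by fast

context inductive_system
begin

lemma rD: "(i, j) \<in> r \<Longrightarrow> i \<in> I" "(i, j) \<in> r \<Longrightarrow> j \<in> I"
  using preorder by (auto simp: preorder_on_def)

lemma r_refl: "i \<in> I \<Longrightarrow> (i, i) \<in> r"
  using preorder by (auto simp: preorder_on_def refl_on_def)

lemma r_trans: "(i, j) \<in> r \<Longrightarrow> (j, k) \<in> r \<Longrightarrow> (i, k) \<in> r"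
  using preorder by (auto simp: preorder_on_def dest: transD)

lemma phi_closed: "(i, j) \<in> r \<Longrightarrow> x \<in> carrier (A i) \<Longrightarrow> \<phi> i j x \<in> carrier (A j)"
  using mon_homD(1)[OF trans_hom] .

lemma phi_mult: "(i, j) \<in> r \<Longrightarrow> x \<in> carrier (A i) \<Longrightarrow> y \<in> carrier (A i) \<Longrightarrow>
    \<phi> i j (x \<otimes>\<^bsub>A i\<^esub> y) = \<phi> i j x \<otimes>\<^bsub>A j\<^esub> \<phi> i j y"
  using mon_homD(2)[OF trans_hom] .

lemma phi_one: "(i, j) \<in> r \<Longrightarrow> \<phi> i j \<one>\<^bsub>A i\<^esub> = \<one>\<^bsub>A j\<^esub>"
  using mon_homD(3)[OF trans_hom] .

definition germ :: "'i \<Rightarrow> 'b \<Rightarrow> ('i \<times> 'b) set" where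
  "germ i x = {(j, y). y \<in> carrier (A j) \<and> (\<exists>k. (i, k) \<in> r \<and> (j, k) \<in> r \<and> \<phi> i k x = \<phi> j k y)}"

definition limit :: "('i \<times> 'b) set monoid" where
  "limit = \<lparr>carrier = {germ i x | i x. i \<in> I \<and> x \<in> carrier (A i)},
     monoid.mult = (\<lambda>X Y. \<Union>{germ k (x \<otimes>\<^bsub>A k\<^esub> y) | k x y. (k, x) \<in> X \<and> (k, y) \<in> Y}),
     one = \<Union>{germ k \<one>\<^bsub>A k\<^esub> | k. k \<in> I}\<rparr>"

lemma germ_self: "i \<in> I \<Longrightarrow> x \<in> carrier (A i) \<Longrightarrow> (i, x) \<in> germ i x"
  unfolding germ_def using r_refl by auto

lemma germ_subset:
  assumes "x \<in> carrier (A i)" "y \<in> carrier (A j)" "(i, k) \<in> r" "(j, k) \<in> r" "\<phi> i k x = \<phi> j k y"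
  shows "germ i x \<subseteq> germ j y"
proof clarify
  fix l z assume "(l, z) \<in> germ i x"
  then obtain m where z: "z \<in> carrier (A l)" and m: "(i, m) \<in> r" "(l, m) \<in> r" "\<phi> i m x = \<phi> l m z"
    by (auto simp: germ_def)
  obtain n where n: "(k, n) \<in> r" "(m, n) \<in> r"
    using directed[OF rD(2)[OF assms(3)] rD(2)[OF m(1)]] by blast
  have "\<phi> j n y = \<phi> k n (\<phi> j k y)" using trans_comp[OF assms(4) n(1) assms(2)] by simp
  also have "\<dots> = \<phi> i n x" using trans_comp[OF assms(3) n(1) assms(1)] assms(5) by simp
  also have "\<dots> = \<phi> m n (\<phi> i m x)" using trans_comp[OF m(1) n(2) assms(1)] by simp
  also have "\<dots> = \<phi> l n z" using trans_comp[OF m(2) n(2) z] m(3) by simp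
  finally show "(l, z) \<in> germ j y"
    unfolding germ_def using z m n assms r_trans by blast
qed

lemma germ_eq_iff:
  assumes "x \<in> carrier (A i)" "y \<in> carrier (A j)" "i \<in> I" "j \<in> I"
  shows "germ i x = germ j y \<longleftrightarrow> (\<exists>k. (i, k) \<in> r \<and> (j, k) \<in> r \<and> \<phi> i k x = \<phi> j k y)"
proof
  assume "germ i x = germ j y"
  then have "(j, y) \<in> germ i x" using germ_self assms by simp
  then show "\<exists>k. (i, k) \<in> r \<and> (j, k) \<in> r \<and> \<phi> i k x = \<phi> j k y" by (auto simp: germ_def)
next
  assume "\<exists>k. (i, k) \<in> r \<and> (j, k) \<in> r \<and> \<phi> i k x = \<phi> j k y"
  then show "germ i x = germ j y"
    using germ_subset[OF assms(1,2)] germ_subset[OF assms(2,1)] by (metis subset_antisym)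
qed

lemma germ_mem:
  assumes "i \<in> I" "x \<in> carrier (A i)" "(j, y) \<in> germ i x"
  shows "j \<in> I" "y \<in> carrier (A j)" "germ j y = germ i x"
proof -
  show j: "j \<in> I" and y: "y \<in> carrier (A j)" using assms(3) rD by (auto simp: germ_def)
  show "germ j y = germ i x" using assms germ_eq_iff[OF y assms(2) j assms(1)] by (auto simp: germ_def)
qed

lemma germ_phi: "(i, j) \<in> r \<Longrightarrow> x \<in> carrier (A i) \<Longrightarrow> germ j (\<phi> i j x) = germ i x"
  using germ_eq_iff[of "\<phi> i j x" j x i] phi_closed[of i j x] rD[of i j] r_refl[of j]
    trans_id[of j "\<phi> i j x"] by auto

lemma germ_mult_cong:
  assumes ij: "i \<in> I" "j \<in> I" and x: "x \<in> carrier (A i)" "y \<in> carrier (A i)"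
    and u: "u \<in> carrier (A j)" "v \<in> carrier (A j)"
    and eq: "germ i x = germ j u" "germ i y = germ j v"
  shows "germ i (x \<otimes>\<^bsub>A i\<^esub> y) = germ j (u \<otimes>\<^bsub>A j\<^esub> v)"
proof -
  obtain k where k: "(i, k) \<in> r" "(j, k) \<in> r" "\<phi> i k x = \<phi> j k u"
    using germ_eq_iff[OF x(1) u(1) ij] eq by auto
  obtain l where l: "(i, l) \<in> r" "(j, l) \<in> r" "\<phi> i l y = \<phi> j l v"
    using germ_eq_iff[OF x(2) u(2) ij] eq by auto
  obtain n where n: "(k, n) \<in> r" "(l, n) \<in> r"
    using directed[OF rD(2)[OF k(1)] rD(2)[OF l(1)]] by blast
  have i: "(i, n) \<in> r" "(j, n) \<in> r" using r_trans[OF k(1) n(1)] r_trans[OF k(2) n(1)] .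
  have 1: "\<phi> i n x = \<phi> j n u" 
    using trans_comp[OF k(1) n(1) x(1)] trans_comp[OF k(2) n(1) u(1)] k(3) by simp
  have 2: "\<phi> i n y = \<phi> j n v" 
    using trans_comp[OF l(1) n(2) x(2)] trans_comp[OF l(2) n(2) u(2)] l(3) by simp
  have "\<phi> i n (x \<otimes>\<^bsub>A i\<^esub> y) = \<phi> j n (u \<otimes>\<^bsub>A j\<^esub> v)"
    using 1 2 phi_mult[OF i(1) x] phi_mult[OF i(2) u] by simp
  moreover have "x \<otimes>\<^bsub>A i\<^esub> y \<in> carrier (A i)" "u \<otimes>\<^bsub>A j\<^esub> v \<in> carrier (A j)"
    using monoids ij x u by (simp_all add: comm_monoid.axioms(1) monoid.m_closed)
  ultimately show ?thesis using germ_eq_iff[OF _ _ ij] i by blast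
qed

lemma limit_mult:
  assumes i: "i \<in> I" and x: "x \<in> carrier (A i)" "y \<in> carrier (A i)"
  shows "germ i x \<otimes>\<^bsub>limit\<^esub> germ i y = germ i (x \<otimes>\<^bsub>A i\<^esub> y)"
proof -
  let ?S = "{germ k (u \<otimes>\<^bsub>A k\<^esub> v) | k u v. (k, u) \<in> germ i x \<and> (k, v) \<in> germ i y}"
  have "?S = {germ i (x \<otimes>\<^bsub>A i\<^esub> y)}"
  proof (intro equalityI subsetI)
    fix Z assume "Z \<in> ?S"
    then obtain k u v where k: "(k, u) \<in> germ i x" "(k, v) \<in> germ i y" and Z: "Z = germ k (u \<otimes>\<^bsub>A k\<^esub> v)"
      by blast
    note u = germ_mem[OF i x(1) k(1)] and v = germ_mem[OF i x(2) k(2)]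
    show "Z \<in> {germ i (x \<otimes>\<^bsub>A i\<^esub> y)}"
      using germ_mult_cong[OF u(1) i u(2) v(2) x u(3) v(3)] Z by simp
  next
    fix Z assume "Z \<in> {germ i (x \<otimes>\<^bsub>A i\<^esub> y)}"
    then show "Z \<in> ?S" using germ_self[OF i x(1)] germ_self[OF i x(2)] by blast
  qed
  then show ?thesis by (simp add: limit_def)
qed

lemma limit_one: assumes i: "i \<in> I" shows "\<one>\<^bsub>limit\<^esub> = germ i \<one>\<^bsub>A i\<^esub>"
proof -
  have "germ k \<one>\<^bsub>A k\<^esub> = germ i \<one>\<^bsub>A i\<^esub>" if k: "k \<in> I" for k
  proof -
    obtain n where n: "(i, n) \<in> r" "(k, n) \<in> r" using directed[OF i k] by blast
    have "\<one>\<^bsub>A j\<^esub> \<in> carrier (A j)" if "j \<in> I" for j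
      using monoids[OF that] by (simp add: comm_monoid.axioms(1) monoid.one_closed)
    then show ?thesis
      using germ_eq_iff[OF _ _ k i] n phi_one[OF n(1)] phi_one[OF n(2)] k i by auto
  qed
  then have "{germ k \<one>\<^bsub>A k\<^esub> | k. k \<in> I} = {germ i \<one>\<^bsub>A i\<^esub>}" using i by blast
  then show ?thesis by (simp add: limit_def)
qed

lemma limit_carrier: "carrier limit = {germ i x | i x. i \<in> I \<and> x \<in> carrier (A i)}"
  by (simp add: limit_def)

lemma limit_common2:
  assumes "X \<in> carrier limit" "Y \<in> carrier limit"
  obtains k x y where "k \<in> I" "x \<in> carrier (A k)" "y \<in> carrier (A k)" "X = germ k x" "Y = germ k y"
proof -
  obtain i x j y where *: "X = germ i x" "Y = germ j y" "i \<in> I" "j \<in> I" "x \<in> carrier (A i)" "y \<in> carrier (A j)"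
    using assms by (auto simp: limit_carrier)
  obtain k where k: "k \<in> I" "(i, k) \<in> r" "(j, k) \<in> r" using directed[OF *(3,4)] by blast
  show ?thesis
    by (rule that[of k "\<phi> i k x" "\<phi> j k y"]) (use * k in \<open>simp_all add: germ_phi phi_closed\<close>)
qed

lemma limit_common3:
  assumes "X \<in> carrier limit" "Y \<in> carrier limit" "Z \<in> carrier limit"
  obtains k x y z where "k \<in> I" "x \<in> carrier (A k)" "y \<in> carrier (A k)" "z \<in> carrier (A k)"
    "X = germ k x" "Y = germ k y" "Z = germ k z"
proof -
  obtain i x y where *: "i \<in> I" "x \<in> carrier (A i)" "y \<in> carrier (A i)" "X = germ i x" "Y = germ i y"
    using limit_common2 assms by blast
  obtain j z where **: "j \<in> I" "z \<in> carrier (A j)" "Z = germ j z"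
    using assms by (auto simp: limit_carrier)
  obtain k where k: "k \<in> I" "(i, k) \<in> r" "(j, k) \<in> r" using directed[OF *(1) **(1)] by blast
  show ?thesis
    by (rule that[of k "\<phi> i k x" "\<phi> i k y" "\<phi> j k z"]) (use * ** k in \<open>simp_all add: germ_phi phi_closed\<close>)
qed

lemma germ_in: "i \<in> I \<Longrightarrow> x \<in> carrier (A i) \<Longrightarrow> germ i x \<in> carrier limit"
  by (auto simp: limit_carrier)

lemma limit_comm_monoid: "comm_monoid limit"
proof (rule comm_monoidI)
  obtain i where i: "i \<in> I" using nonempty by blast
  interpret Ai: comm_monoid "A i" using monoids i .
  show "\<one>\<^bsub>limit\<^esub> \<in> carrier limit" using limit_one[OF i] germ_in[OF i] by simp
next
  fix X Y assume "X \<in> carrier limit" "Y \<in> carrier limit"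
  then obtain k x y where k: "k \<in> I" "x \<in> carrier (A k)" "y \<in> carrier (A k)" "X = germ k x" "Y = germ k y"
    by (rule limit_common2)
  interpret Ak: comm_monoid "A k" using monoids k by blast
  show "X \<otimes>\<^bsub>limit\<^esub> Y \<in> carrier limit" using k limit_mult germ_in by simp
  show "X \<otimes>\<^bsub>limit\<^esub> Y = Y \<otimes>\<^bsub>limit\<^esub> X" using k limit_mult Ak.m_comm by simp
next
  fix X Y Z assume "X \<in> carrier limit" "Y \<in> carrier limit" "Z \<in> carrier limit"
  then obtain k x y z where k: "k \<in> I" "x \<in> carrier (A k)" "y \<in> carrier (A k)" "z \<in> carrier (A k)"
    "X = germ k x" "Y = germ k y" "Z = germ k z"
    by (rule limit_common3)
  interpret Ak: comm_monoid "A k" using monoids k by blast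
  show "(X \<otimes>\<^bsub>limit\<^esub> Y) \<otimes>\<^bsub>limit\<^esub> Z = X \<otimes>\<^bsub>limit\<^esub> (Y \<otimes>\<^bsub>limit\<^esub> Z)"
    using k limit_mult Ak.m_assoc by simp
next
  fix X assume "X \<in> carrier limit"
  then obtain k x where k: "k \<in> I" "x \<in> carrier (A k)" "X = germ k x"
    by (auto simp: limit_carrier)
  interpret Ak: comm_monoid "A k" using monoids k by blast
  show "\<one>\<^bsub>limit\<^esub> \<otimes>\<^bsub>limit\<^esub> X = X" using k limit_mult limit_one[OF k(1)] by simp
qed

lemma limit_cocone: "cocone I r A \<phi> limit germ"
proof (rule coconeI)
  show "comm_monoid limit" by (rule limit_comm_monoid)
  show "germ i \<in> mon_hom (A i) limit" if i: "i \<in> I" for i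
  proof (rule mon_homI)
    show "germ i x \<in> carrier limit" if "x \<in> carrier (A i)" for x
      using germ_in[OF i that] .
    show "germ i (x \<otimes>\<^bsub>A i\<^esub> y) = germ i x \<otimes>\<^bsub>limit\<^esub> germ i y" if "x \<in> carrier (A i)" "y \<in> carrier (A i)" for x y
      using limit_mult[OF i that] by (rule sym)
    show "germ i \<one>\<^bsub>A i\<^esub> = \<one>\<^bsub>limit\<^esub>" using limit_one[OF i] by (rule sym)
  qed
  show "germ j (\<phi> i j x) = germ i x" if "(i, j) \<in> r" "x \<in> carrier (A i)" for i j x
    using germ_phi[OF that] .
qed

lemma limit_desc:
  assumes T: "cocone I r A \<phi> T \<xi>"
  obtains g where "g \<in> mon_hom limit T" "\<And>i x. i \<in> I \<Longrightarrow> x \<in> carrier (A i) \<Longrightarrow> g (germ i x) = \<xi> i x"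
proof -
  have hom: "\<xi> i \<in> mon_hom (A i) T" if "i \<in> I" for i using coconeD(2)[OF T that] .
  have comp: "\<xi> j (\<phi> i j x) = \<xi> i x" if "(i, j) \<in> r" "x \<in> carrier (A i)" for i j x
    using coconeD(3)[OF T that] .
  define g where "g X = (SOME t. \<exists>i x. (i, x) \<in> X \<and> t = \<xi> i x)" for X
  have g: "g (germ i x) = \<xi> i x" if i: "i \<in> I" "x \<in> carrier (A i)" for i x
  proof -
    have *: "\<xi> j y = \<xi> i x" if "(j, y) \<in> germ i x" for j y
    proof -
      from that obtain k where "y \<in> carrier (A j)" "(i, k) \<in> r" "(j, k) \<in> r" "\<phi> i k x = \<phi> j k y"
        by (auto simp: germ_def)
      then show ?thesis using comp[of i k x] comp[of j k y] i by simp
    qed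
    have "\<exists>j y. (j, y) \<in> germ i x \<and> g (germ i x) = \<xi> j y"
      unfolding g_def by (rule someI_ex) (use germ_self[OF i] in blast)
    then show ?thesis using * by force
  qed
  have "g \<in> mon_hom limit T"
  proof (rule mon_homI)
    fix X assume "X \<in> carrier limit"
    then show "g X \<in> carrier T" using g mon_homD(1)[OF hom] by (auto simp: limit_carrier)
  next
    fix X Y assume "X \<in> carrier limit" "Y \<in> carrier limit"
    then obtain k x y where k: "k \<in> I" "x \<in> carrier (A k)" "y \<in> carrier (A k)" "X = germ k x" "Y = germ k y"
      by (rule limit_common2)
    interpret Ak: comm_monoid "A k" using monoids k by blast
    show "g (X \<otimes>\<^bsub>limit\<^esub> Y) = g X \<otimes>\<^bsub>T\<^esub> g Y"
      using k g limit_mult mon_homD(2)[OF hom[OF k(1)] k(2,3)] by simp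
  next
    obtain i where i: "i \<in> I" using nonempty by blast
    interpret Ai: comm_monoid "A i" using monoids i .
    show "g \<one>\<^bsub>limit\<^esub> = \<one>\<^bsub>T\<^esub>" using limit_one[OF i] g[OF i Ai.one_closed] mon_homD(3)[OF hom[OF i]] by simp
  qed
  then show ?thesis by (rule that[OF _ g])
qed

end

lemma mon_hom_comp: "g \<in> mon_hom G H \<Longrightarrow> h \<in> mon_hom H K \<Longrightarrow> (\<lambda>x. h (g x)) \<in> mon_hom G K"
  by (rule mon_homI) (simp_all add: mon_homD[of g G H] mon_homD[of h H K])

lemma universal_cocone_exists:
  fixes T :: "'c monoid"
  assumes "universal_cocone TYPE('c) I r A \<phi> M \<psi>" "cocone I r A \<phi> T \<xi>"
  shows "\<exists>h\<in>mon_hom M T. \<forall>i\<in>I. \<forall>x\<in>carrier (A i). h (\<psi> i x) = \<xi> i x"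
  using assms(1)[unfolded universal_cocone_def, THEN spec, THEN spec, THEN mp, OF assms(2)] by (elim bexE conjE) (rule bexI)

lemma universal_cocone_unique:
  fixes T :: "'c monoid"
  assumes univ: "universal_cocone TYPE('c) I r A \<phi> M \<psi>" "cocone I r A \<phi> T \<xi>"
    and f: "f \<in> mon_hom M T" "\<forall>i\<in>I. \<forall>x\<in>carrier (A i). f (\<psi> i x) = \<xi> i x"
    and g: "g \<in> mon_hom M T" "\<forall>i\<in>I. \<forall>x\<in>carrier (A i). g (\<psi> i x) = \<xi> i x"
    and z: "z \<in> carrier M"
  shows "f z = g z"
proof -
  obtain h where h: "\<forall>h'\<in>mon_hom M T. (\<forall>i\<in>I. \<forall>x\<in>carrier (A i). h' (\<psi> i x) = \<xi> i x) \<longrightarrow>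
      (\<forall>x\<in>carrier M. h' x = h x)"
    using univ(1)[unfolded universal_cocone_def, THEN spec, THEN spec, THEN mp, OF univ(2)]
    by (elim bexE conjE) (rule that)
  have "f z = h z" by (rule h[THEN bspec, OF f(1), THEN mp, OF f(2), THEN bspec, OF z])
  also have "h z = g z" by (rule h[THEN bspec, OF g(1), THEN mp, OF g(2), THEN bspec, OF z, symmetric])
  finally show ?thesis .
qed

lemma inductive_limit_concrete:
  fixes I :: "'i set" and A :: "'i \<Rightarrow> 'b monoid" and M :: "'a monoid"
  assumes lim: "inductive_limit I r A \<phi> M \<psi>"
  shows "z \<in> carrier M \<Longrightarrow> \<exists>i\<in>I. \<exists>x\<in>carrier (A i). z = \<psi> i x"
    and "\<lbrakk>i \<in> I; j \<in> I; x \<in> carrier (A i); y \<in> carrier (A j); \<psi> i x = \<psi> j y\<rbrakk>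
          \<Longrightarrow> \<exists>k. (i, k) \<in> r \<and> (j, k) \<in> r \<and> \<phi> i k x = \<phi> j k y"
proof -
  interpret inductive_system I r A \<phi> using lim by (simp add: inductive_limit_def)
  have univ: "universal_cocone TYPE('a) I r A \<phi> M \<psi>" "universal_cocone TYPE(('i \<times> 'b) set) I r A \<phi> M \<psi>"
    using lim by (simp_all add: inductive_limit_def)
  have M: "cocone I r A \<phi> M \<psi>" using lim by (simp add: inductive_limit_def)
  obtain h where h: "h \<in> mon_hom M limit" "\<And>i x. i \<in> I \<Longrightarrow> x \<in> carrier (A i) \<Longrightarrow> h (\<psi> i x) = germ i x"
    using universal_cocone_exists[OF univ(2) limit_cocone] by blast
  obtain g where g: "g \<in> mon_hom limit M" "\<And>i x. i \<in> I \<Longrightarrow> x \<in> carrier (A i) \<Longrightarrow> g (germ i x) = \<psi> i x"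
    using limit_desc[OF M] by blast
  have id: "(\<lambda>x. x) \<in> mon_hom M M" by (rule mon_homI) auto
  have gh: "g (h z) = z" if "z \<in> carrier M" for z
    by (rule universal_cocone_unique[OF univ(1) M mon_hom_comp[OF h(1) g(1)] _ id _ that])
      (simp_all add: h(2) g(2))
  show "\<exists>i\<in>I. \<exists>x\<in>carrier (A i). z = \<psi> i x" if z: "z \<in> carrier M" for z
  proof -
    have "h z \<in> carrier limit" using mon_homD(1)[OF h(1) z] .
    then obtain i x where "i \<in> I" "x \<in> carrier (A i)" "h z = germ i x" by (auto simp: limit_carrier)
    moreover have "z = g (h z)" using gh[OF z] by simp
    ultimately show ?thesis using g(2) by auto
  qed
  show "\<exists>k. (i, k) \<in> r \<and> (j, k) \<in> r \<and> \<phi> i k x = \<phi> j k y"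
    if "i \<in> I" "j \<in> I" "x \<in> carrier (A i)" "y \<in> carrier (A j)" "\<psi> i x = \<psi> j y" for i j x y
    using germ_eq_iff[OF that(3,4,1,2)] h(2)[OF that(1,3)] h(2)[OF that(2,4)] that(5) by simp
qed

lemma inductive_limit_universal:
  fixes I :: "'i set" and A :: "'i \<Rightarrow> 'b monoid" and M :: "'a monoid"
  assumes lim: "inductive_limit I r A \<phi> M \<psi>"
  shows "universal_cocone TYPE('c) I r A \<phi> M \<psi>"
  unfolding universal_cocone_def
proof (intro allI impI)
  fix T :: "'c monoid" and \<xi> assume T: "cocone I r A \<phi> T \<xi>"
  interpret inductive_system I r A \<phi> using lim by (simp add: inductive_limit_def)
  have univ: "universal_cocone TYPE(('i \<times> 'b) set) I r A \<phi> M \<psi>"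
    using lim by (simp add: inductive_limit_def)
  obtain h where h: "h \<in> mon_hom M limit" "\<And>i x. i \<in> I \<Longrightarrow> x \<in> carrier (A i) \<Longrightarrow> h (\<psi> i x) = germ i x"
    using universal_cocone_exists[OF univ limit_cocone] by blast
  obtain g where g: "g \<in> mon_hom limit T" "\<And>i x. i \<in> I \<Longrightarrow> x \<in> carrier (A i) \<Longrightarrow> g (germ i x) = \<xi> i x"
    using limit_desc[OF T] by blast
  show "\<exists>f\<in>mon_hom M T. (\<forall>i\<in>I. \<forall>x\<in>carrier (A i). f (\<psi> i x) = \<xi> i x) \<and>
          (\<forall>f'\<in>mon_hom M T. (\<forall>i\<in>I. \<forall>x\<in>carrier (A i). f' (\<psi> i x) = \<xi> i x) \<longrightarrow>
             (\<forall>x\<in>carrier M. f' x = f x))"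
  proof (intro bexI conjI ballI impI)
    show "(\<lambda>x. g (h x)) \<in> mon_hom M T" using mon_hom_comp[OF h(1) g(1)] .
    show 1: "g (h (\<psi> i x)) = \<xi> i x" if "i \<in> I" "x \<in> carrier (A i)" for i x using that h(2) g(2) by simp
    fix f' z assume f': "\<forall>i\<in>I. \<forall>x\<in>carrier (A i). f' (\<psi> i x) = \<xi> i x" and "z \<in> carrier M"
    then obtain i x where "i \<in> I" "x \<in> carrier (A i)" "z = \<psi> i x"
      using inductive_limit_concrete(1)[OF lim] by blast
    then show "f' z = g (h z)" using 1 f' by simp
  qed
qed

end

theory Submission
  imports Defs Complex_Main "HOL-Algebra.FiniteProduct"
begin

text \<open>
  The notation is multiplicative, but multiples and sums are spoken of additively below: \<open>n p\<close> is
  \<open>p [^] n\<close>, and \<open>x + y\<close> is \<open>x \<otimes> y\<close>.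

  The three properties speak of finitely many elements and finitely many equations between them.  In
  a directed limit all of these already occur at some stage, so the properties pass from the
  stages to the limit, and it remains to prove them for a finitely generated refinement monoid.

  Such a monoid is generated by its prime elements, where \<open>p\<close> is prime if \<open>p \<le> a + b\<close> implies
  \<open>p \<le> a\<close> or \<open>p \<le> b\<close>.  By Dickson's lemma the algebraic preorder has no infinite strictly descending
  chain (\<open>finitely_generated_wf\<close>).  If \<open>x\<close> is not prime, then \<open>x \<le> a + b\<close> for some \<open>a\<close> and \<open>b\<close> that
  are not above \<open>x\<close>, and refinement splits \<open>x\<close> into a part below \<open>a\<close> and a part below \<open>b\<close>.  Both
  parts are strictly below \<open>x\<close>, so well-founded induction applies.

  For a prime \<open>p\<close> let \<open>\<mu>\<^sub>p(x)\<close> be the supremum of the \<open>n\<close> with \<open>n p \<le> x\<close>, a natural number or infinity.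
  Refinement makes \<open>\<mu>\<^sub>p\<close> additive (\<open>prime_pow_le_mult\<close>).  These functions determine the preorder of a
  primely generated refinement monoid, and \<open>x \<le> y\<close> follows already
  from \<open>n p \<le> y\<close> for finitely many pairs \<open>(p, n)\<close> with \<open>n p \<le> x\<close> (\<open>prime_sums_finite_test\<close>).  Hence \<open>m x \<le> m y\<close> implies \<open>x \<le> y\<close>, since the same holds in
  the natural numbers with infinity.  For interpolation, start with \<open>x\<^sub>1\<close> and enlarge it step by
  step, staying below \<open>y\<^sub>1\<close> and \<open>y\<^sub>2\<close>, until it satisfies the finitely many inequalities
  that put it above \<open>x\<^sub>2\<close> (\<open>extend_below\<close>).

  Separativity is not a statement about the preorder alone.  It rests on a cancellation law: a prime
  \<open>p\<close> below both \<open>a\<close> and \<open>b\<close> can be cancelled from \<open>a + p = b + p\<close> (\<open>prime_cancel\<close>), and so can a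
  sum of primes.  If \<open>2 x = 2 y = x + y\<close>, then \<open>x \<le> y\<close> because the monoid is unperforated, and \<open>x\<close>
  may be cancelled from \<open>x + x = y + x\<close>.
\<close>

section \<open>The algebraic preorder\<close>

notation alg_le  ("(_ \<preceq>\<index> _)" [51, 51] 50)

context comm_monoid
begin

lemma leI: "z \<in> carrier G \<Longrightarrow> x \<otimes> z = y \<Longrightarrow> x \<preceq> y"
  by (auto simp: alg_le_def)

lemma leE:
  assumes "x \<preceq> y"
  obtains z where "z \<in> carrier G" "y = x \<otimes> z"
  using assms by (auto simp: alg_le_def)

lemma le_refl: "x \<in> carrier G \<Longrightarrow> x \<preceq> x"
  by (rule leI[of \<one>]) auto

lemma one_le: "x \<in> carrier G \<Longrightarrow> \<one> \<preceq> x"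
  by (rule leI[of x]) auto

lemma le_trans:
  assumes "x \<in> carrier G" "x \<preceq> y" "y \<preceq> z"
  shows "x \<preceq> z"
proof -
  obtain u where u: "u \<in> carrier G" "y = x \<otimes> u" using assms(2) by (rule leE)
  obtain v where v: "v \<in> carrier G" "z = y \<otimes> v" using assms(3) by (rule leE)
  show ?thesis by (rule leI[of "u \<otimes> v"]) (use u v assms(1) in \<open>simp_all add: m_assoc\<close>)
qed

lemma le_mult_right: "x \<in> carrier G \<Longrightarrow> y \<in> carrier G \<Longrightarrow> x \<preceq> x \<otimes> y"
  by (rule leI[of y]) auto

lemma le_mult_left: "x \<in> carrier G \<Longrightarrow> y \<in> carrier G \<Longrightarrow> y \<preceq> x \<otimes> y"
  by (rule leI[of x]) (auto simp: m_comm)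

lemma mult_mono:
  assumes "x \<in> carrier G" "y \<in> carrier G" "x \<preceq> u" "y \<preceq> v"
  shows "x \<otimes> y \<preceq> u \<otimes> v"
proof -
  obtain a where a: "a \<in> carrier G" "u = x \<otimes> a" using assms(3) by (rule leE)
  obtain b where b: "b \<in> carrier G" "v = y \<otimes> b" using assms(4) by (rule leE)
  show ?thesis by (rule leI[of "a \<otimes> b"]) (use a b assms in \<open>simp_all add: m_ac\<close>)
qed

lemma pow_mono: "x \<in> carrier G \<Longrightarrow> x \<preceq> y \<Longrightarrow> x [^] (n::nat) \<preceq> y [^] n"
  by (induction n) (simp_all add: le_refl mult_mono)

lemma pow_le_pow:
  assumes "x \<in> carrier G" "m \<le> n"
  shows "x [^] (m::nat) \<preceq> x [^] (n::nat)"
  by (rule leI[of "x [^] (n - m)"]) (use assms in \<open>simp_all add: nat_pow_mult\<close>)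

end

lemma mon_hom_le:
  assumes "h \<in> mon_hom G H" "x \<in> carrier G" "alg_le G x y"
  shows "alg_le H (h x) (h y)"
proof -
  obtain z where z: "z \<in> carrier G" "y = x \<otimes>\<^bsub>G\<^esub> z" using assms(3) by (auto simp: alg_le_def)
  then show ?thesis
    using mon_homD(1)[OF assms(1) z(1)] mon_homD(2)[OF assms(1,2) z(1)] by (auto simp: alg_le_def)
qed

lemma mon_hom_pow:
  assumes "monoid G" "monoid H" "h \<in> mon_hom G H" "x \<in> carrier G"
  shows "h (x [^]\<^bsub>G\<^esub> (n::nat)) = h x [^]\<^bsub>H\<^esub> n"
  using assms by (induction n) (simp_all add: mon_homD monoid.nat_pow_closed monoid.nat_pow_Suc monoid.nat_pow_0)

section \<open>Prime elements and their multiplicities\<close>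

text \<open>
  An invertible element lies below every element and therefore counts as prime.  Thus sums of primes
  can exhaust a monoid that has invertible elements, a group for instance.
\<close>

definition prime_element :: "('a, 'm) monoid_scheme \<Rightarrow> 'a \<Rightarrow> bool" where
  "prime_element M p \<longleftrightarrow> p \<in> carrier M \<and> (\<forall>a\<in>carrier M. \<forall>b\<in>carrier M.
     alg_le M p (a \<otimes>\<^bsub>M\<^esub> b) \<longrightarrow> alg_le M p a \<or> alg_le M p b)"

inductive_set prime_sums :: "('a, 'm) monoid_scheme \<Rightarrow> 'a set" for M where
  one: "\<one>\<^bsub>M\<^esub> \<in> prime_sums M"
| mult: "\<lbrakk>prime_element M p; x \<in> prime_sums M\<rbrakk> \<Longrightarrow> p \<otimes>\<^bsub>M\<^esub> x \<in> prime_sums M"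

lemma prime_closed: "prime_element M p \<Longrightarrow> p \<in> carrier M"
  by (simp add: prime_element_def)

context comm_monoid
begin

lemma primeD:
  "\<lbrakk>prime_element G p; p \<preceq> a \<otimes> b; a \<in> carrier G; b \<in> carrier G\<rbrakk> \<Longrightarrow> p \<preceq> a \<or> p \<preceq> b"
  by (simp add: prime_element_def)

lemma prime_sums_closed: "x \<in> prime_sums G \<Longrightarrow> x \<in> carrier G"
  by (induction rule: prime_sums.induct) (auto dest: prime_closed)

lemma prime_sums_mult:
  assumes "x \<in> prime_sums G" "y \<in> prime_sums G"
  shows "x \<otimes> y \<in> prime_sums G"
  using assms(1)
proof (induction rule: prime_sums.induct)
  case one
  then show ?case using assms(2) prime_sums_closed by simp
next
  case (mult p x)
  have "p \<otimes> x \<otimes> y = p \<otimes> (x \<otimes> y)"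
    using mult.hyps assms(2) by (simp add: m_assoc prime_closed prime_sums_closed)
  then show ?case using prime_sums.mult[OF mult.hyps(1) mult.IH] by simp
qed

lemma prime_in_prime_sums: "prime_element G p \<Longrightarrow> p \<in> prime_sums G"
  using prime_sums.mult[OF _ prime_sums.one, of G p] prime_closed[of G p] by simp

text \<open>
  Write \<open>q = p + (p + s)\<close>.  As \<open>q\<close> is prime, it lies below \<open>p + s\<close>, and then adding \<open>p\<close> gives the
  claim, or below \<open>p\<close>, and then \<open>p + q \<le> p + p \<le> q\<close>.
\<close>

lemma prime_absorbed:
  assumes p: "prime_element G p" and q: "prime_element G q" and le: "p \<otimes> p \<preceq> q"
  shows "p \<otimes> q \<preceq> q"
proof -
  have [simp]: "p \<in> carrier G" "q \<in> carrier G" using p q by (auto intro: prime_closed)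
  obtain s where s [simp]: "s \<in> carrier G" and qs: "q = p \<otimes> p \<otimes> s" using le by (rule leE)
  have "q \<preceq> p \<otimes> (p \<otimes> s)" using qs le_refl[of q] by (simp add: m_assoc)
  then consider "q \<preceq> p" | "q \<preceq> p \<otimes> s" using primeD[OF q, of p "p \<otimes> s"] by auto
  then show ?thesis
  proof cases
    case 1
    have "p \<otimes> q \<preceq> p \<otimes> p" using 1 by (simp add: mult_mono le_refl)
    then show ?thesis using le le_trans by (meson \<open>p \<in> carrier G\<close> \<open>q \<in> carrier G\<close> m_closed)
  next
    case 2
    then have "p \<otimes> q \<preceq> p \<otimes> (p \<otimes> s)" by (simp add: mult_mono le_refl)
    then show ?thesis using qs by (simp add: m_assoc)
  qed
qed

end

context refinement_monoid
begin

text \<open>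
  Additivity of \<open>\<mu>\<^sub>p\<close>.  Refining the equation \<open>p + (k p + w) = x + y\<close> sends one copy of \<open>p\<close> below a part
  of \<open>x\<close> or of \<open>y\<close>, because \<open>p\<close> is prime; the other copies go into the complementary parts.
\<close>

lemma prime_pow_le_mult:
  assumes p: "prime_element M p" and "x \<in> carrier M" "y \<in> carrier M" "p [^] (k::nat) \<preceq> x \<otimes> y"
  shows "\<exists>i j. i + j = k \<and> p [^] i \<preceq> x \<and> p [^] j \<preceq> y"
  using assms(2-)
proof (induction k arbitrary: x y)
  case 0
  then show ?case by (auto simp: one_le)
next
  case (Suc k)
  have pc [simp]: "p \<in> carrier M" using p by (rule prime_closed)
  obtain w where w: "w \<in> carrier M" "x \<otimes> y = p [^] Suc k \<otimes> w" using Suc.prems(3) by (rule leE)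
  then have "p \<otimes> (p [^] k \<otimes> w) = x \<otimes> y" by (simp add: m_ac)
  from refinement[OF pc _ Suc.prems(1,2) this] w(1)
  obtain a b c d where z [simp]: "a \<in> carrier M" "b \<in> carrier M" "c \<in> carrier M" "d \<in> carrier M"
    and eq: "p = a \<otimes> b" "p [^] k \<otimes> w = c \<otimes> d" "x = a \<otimes> c" "y = b \<otimes> d"
    by auto
  have "p [^] k \<preceq> c \<otimes> d" using leI[OF w(1) eq(2)] .
  then obtain i j where ij: "i + j = k" "p [^] i \<preceq> c" "p [^] j \<preceq> d" using Suc.IH[of c d] by auto
  have "p \<preceq> a \<otimes> b" using eq(1) le_refl[OF pc] by simp
  then consider "p \<preceq> a" | "p \<preceq> b" using primeD[OF p _ z(1,2)] by blast
  then show ?case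
  proof cases
    case 1
    have "p [^] Suc i \<preceq> x" using mult_mono[OF pc _ 1 ij(2)] eq(3) by (simp add: m_comm)
    moreover have "p [^] j \<preceq> y" using le_trans[OF _ ij(3) le_mult_left[of b d]] eq(4) by simp
    ultimately show ?thesis using ij(1) by (intro exI[of _ "Suc i"] exI[of _ j]) simp
  next
    case 2
    have "p [^] Suc j \<preceq> y" using mult_mono[OF pc _ 2 ij(3)] eq(4) by (simp add: m_comm)
    moreover have "p [^] i \<preceq> x" using le_trans[OF _ ij(2) le_mult_left[of a c]] eq(3) by simp
    ultimately show ?thesis using ij(1) by (intro exI[of _ i] exI[of _ "Suc j"]) simp
  qed
qed

text \<open>
  Finite multiplicities can be subtracted: at most \<open>k\<close> of the \<open>k + n\<close> copies of \<open>p\<close> find room in \<open>x\<close>.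
\<close>

lemma prime_pow_le_cofactor:
  assumes p: "prime_element M p" and "x \<in> carrier M" "y \<in> carrier M"
    and bound: "\<not> p [^] Suc k \<preceq> x" and le: "p [^] (k + n) \<preceq> x \<otimes> y"
  shows "p [^] n \<preceq> y"
proof -
  have pc: "p \<in> carrier M" using p by (rule prime_closed)
  obtain i j where ij: "i + j = k + n" "p [^] i \<preceq> x" "p [^] j \<preceq> y"
    using prime_pow_le_mult[OF p assms(2,3) le] by blast
  have "\<not> Suc k \<le> i" using bound le_trans[OF _ pow_le_pow[OF pc] ij(2)] pc by blast
  then have "n \<le> j" using ij(1) by simp
  then show ?thesis using le_trans[OF _ pow_le_pow[OF pc] ij(3)] pc by blast
qed

text \<open>
  If \<open>\<mu>\<^sub>p(x)\<close> is infinite for a sum \<open>x\<close> of primes, then by additivity \<open>\<mu>\<^sub>p\<close> is infinite at some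
  summand \<open>q\<close>, and already \<open>2 p \<le> q\<close> makes \<open>q\<close> absorb \<open>p\<close> up to the preorder.
\<close>

lemma prime_pow_unbounded_absorbed:
  assumes p: "prime_element M p" and "x \<in> prime_sums M" "\<And>n::nat. p [^] n \<preceq> x"
  shows "p \<otimes> x \<preceq> x"
  using assms(2-)
proof (induction rule: prime_sums.induct)
  case one
  from one[of 1] show ?case using prime_closed[OF p] by simp
next
  case (mult q x)
  have [simp]: "p \<in> carrier M" "q \<in> carrier M" "x \<in> carrier M"
    using p mult.hyps by (auto intro: prime_closed prime_sums_closed)
  show ?case
  proof (cases "\<forall>n::nat. p [^] n \<preceq> x")
    case True
    have "q \<otimes> (p \<otimes> x) \<preceq> q \<otimes> x" using mult.IH True by (simp add: mult_mono le_refl)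
    then show ?thesis by (simp add: m_lcomm)
  next
    case False
    then obtain k :: nat where k: "\<not> p [^] k \<preceq> x" by blast
    then have "\<not> p [^] Suc k \<preceq> x" using le_trans[OF _ pow_le_pow[of p k "Suc k"]] by auto
    moreover have "p [^] (k + 2) \<preceq> x \<otimes> q" using mult.prems[of "k + 2"] by (simp add: m_comm)
    ultimately have "p [^] (2::nat) \<preceq> q" using prime_pow_le_cofactor[OF p, of x q k 2] by simp
    then have "p \<otimes> q \<preceq> q"
      using prime_absorbed[OF p mult.hyps(1)] by (simp add: numeral_2_eq_2)
    then have "p \<otimes> q \<otimes> x \<preceq> q \<otimes> x" by (simp add: mult_mono le_refl)
    then show ?thesis by (simp add: m_assoc)
  qed
qed

lemma prime_pow_exact:
  assumes "p \<in> carrier M" "x \<in> carrier M" "\<not> p [^] (n::nat) \<preceq> x"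
  obtains k where "k < n" "p [^] k \<preceq> x" "\<not> p [^] Suc k \<preceq> x"
proof -
  define N :: nat where "N = (LEAST m. \<not> p [^] m \<preceq> x)"
  have N: "\<not> p [^] N \<preceq> x" "N \<le> n"
    unfolding N_def using assms(3) by (rule LeastI, rule Least_le)
  have "N \<noteq> 0" using N(1) one_le[OF assms(2)] by (metis nat_pow_0)
  then obtain k where k: "N = Suc k" using not0_implies_Suc by blast
  have "p [^] k \<preceq> x" using not_less_Least[of k "\<lambda>m. \<not> p [^] m \<preceq> x"] k N_def by auto
  then show ?thesis using that[of k] N k by auto
qed

text \<open>
  The test is built up along the sum.  Suppose that \<open>p\<close> is added to \<open>x\<close>.  If \<open>\<mu>\<^sub>p(x)\<close> is infinite, then \<open>x\<close> absorbs \<open>p\<close> up to the preorder, and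
  the test for \<open>x\<close> still works.  If \<open>\<mu>\<^sub>p(x) = k\<close>, then the test gets the additional inequality
  \<open>(k + 1) p \<le> y\<close>: an element \<open>y = x + v\<close> that passes it has \<open>\<mu>\<^sub>p(v) \<ge> 1\<close>, so \<open>x + p \<le> y\<close>.
\<close>

lemma prime_sums_finite_test:
  assumes "x \<in> prime_sums M"
  shows "\<exists>L :: ('a \<times> nat) set. finite L \<and> (\<forall>(p, n)\<in>L. prime_element M p \<and> p [^] n \<preceq> x) \<and>
     (\<forall>y\<in>carrier M. (\<forall>(p, n)\<in>L. p [^] n \<preceq> y) \<longrightarrow> x \<preceq> y)"
  (is "\<exists>L. ?P L x")
  using assms
proof (induction rule: prime_sums.induct)
  case one
  show ?case by (rule exI[of _ "{}"]) (simp add: one_le)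
next
  case (mult p x)
  have [simp]: "p \<in> carrier M" "x \<in> carrier M"
    using mult.hyps by (auto intro: prime_closed prime_sums_closed)
  obtain L :: "('a \<times> nat) set" where L: "?P L x" using mult.IH by blast
  have above: "q [^] n \<preceq> p \<otimes> x" if "(q, n) \<in> L" for q n
    using L that le_trans[OF _ _ le_mult_left[of p x], of "q [^] n"] prime_closed[of M q]
    by auto
  show ?case
  proof (cases "\<forall>n::nat. p [^] n \<preceq> x")
    case True
    then have "p \<otimes> x \<preceq> x" using prime_pow_unbounded_absorbed[OF mult.hyps] by blast
    then have "?P L (p \<otimes> x)" using L above le_trans[of "p \<otimes> x" x] by (auto 0 3)
    then show ?thesis by blast
  next
    case False
    then obtain k where k: "p [^] k \<preceq> x" "\<not> p [^] Suc k \<preceq> x"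
      using prime_pow_exact[of p x] by auto
    have "p [^] Suc k \<preceq> p \<otimes> x"
      using mult_mono[of p "p [^] k" p x] k(1) by (simp add: m_comm le_refl)
    moreover have "p \<otimes> x \<preceq> y"
      if y: "y \<in> carrier M" "x \<preceq> y" "p [^] Suc k \<preceq> y" for y
    proof -
      obtain v where v: "v \<in> carrier M" "y = x \<otimes> v" using y(2) by (rule leE)
      have "p [^] (1::nat) \<preceq> v"
        using prime_pow_le_cofactor[OF mult.hyps(1) _ v(1) k(2), of 1] y(3) v(2) by simp
      then have "x \<otimes> p \<preceq> x \<otimes> v" by (simp add: mult_mono le_refl)
      then show ?thesis using v(2) by (simp add: m_comm)
    qed
    ultimately have "?P (insert (p, Suc k) L) (p \<otimes> x)" using L above mult.hyps(1) by auto
    then show ?thesis by blast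
  qed
qed

text \<open>
  By additivity \<open>\<mu>\<^sub>p(m y) = m \<mu>\<^sub>p(y)\<close>, and a positive factor \<open>m\<close> can be cancelled from
  \<open>n m \<le> m \<mu>\<^sub>p(y)\<close>.
\<close>

lemma prime_root_le:
  assumes p: "prime_element M p" and y: "y \<in> carrier M" and "1 \<le> m" "p [^] (n * m) \<preceq> y [^] (m::nat)"
  shows "p [^] (n::nat) \<preceq> y"
  using assms(3-)
proof (induction m rule: dec_induct)
  case base
  then show ?case using y by simp
next
  case (step m)
  have pc: "p \<in> carrier M" using p by (rule prime_closed)
  have "p [^] (n * Suc m) \<preceq> y [^] m \<otimes> y" using step.prems by simp
  then obtain i j where ij: "i + j = n * Suc m" "p [^] i \<preceq> y [^] m" "p [^] j \<preceq> y"
    using prime_pow_le_mult[OF p] y by blast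
  show ?case
  proof (cases "n \<le> j")
    case True
    then show ?thesis using le_trans[OF _ pow_le_pow[OF pc] ij(3)] pc by blast
  next
    case False
    then have "n * m \<le> i" using ij(1) by simp
    then show ?thesis using step.IH le_trans[OF _ pow_le_pow[OF pc] ij(2)] pc by blast
  qed
qed

text \<open>
  If \<open>\<mu>\<^sub>p(z) = k < n\<close>, then \<open>z + (n - k) p\<close> is still below each \<open>y = z + v\<close> in \<open>Y\<close>, since
  \<open>\<mu>\<^sub>p(y) \<ge> n\<close> forces \<open>\<mu>\<^sub>p(v) \<ge> n - k\<close>.
\<close>

lemma extend_below:
  assumes p: "prime_element M p" and z: "z \<in> carrier M"
    and y: "\<And>y. y \<in> Y \<Longrightarrow> y \<in> carrier M \<and> z \<preceq> y \<and> p [^] (n::nat) \<preceq> y"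
  shows "\<exists>z'\<in>carrier M. z \<preceq> z' \<and> p [^] n \<preceq> z' \<and> (\<forall>y\<in>Y. z' \<preceq> y)"
proof (cases "p [^] n \<preceq> z")
  case True
  then show ?thesis using z y le_refl by blast
next
  case False
  have pc [simp]: "p \<in> carrier M" using p by (rule prime_closed)
  obtain k where k: "k < n" "p [^] k \<preceq> z" "\<not> p [^] Suc k \<preceq> z"
    using prime_pow_exact[OF pc z False] .
  have kn: "k + (n - k) = n" using k(1) by simp
  have below: "z \<otimes> p [^] (n - k) \<preceq> y" if "y \<in> Y" for y
  proof -
    obtain v where v: "v \<in> carrier M" "y = z \<otimes> v" using y[OF \<open>y \<in> Y\<close>] by (auto elim: leE)
    have "p [^] (n - k) \<preceq> v"
      using prime_pow_le_cofactor[OF p z v(1) k(3), of "n - k"] y[OF \<open>y \<in> Y\<close>] v(2) kn by simp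
    then show ?thesis using z v by (simp add: mult_mono le_refl)
  qed
  have "p [^] k \<otimes> p [^] (n - k) \<preceq> z \<otimes> p [^] (n - k)"
    using k(2) z by (simp add: mult_mono le_refl)
  then have "p [^] n \<preceq> z \<otimes> p [^] (n - k)" by (simp add: nat_pow_mult kn)
  then show ?thesis
    using below z by (intro bexI[of _ "z \<otimes> p [^] (n - k)"]) (auto simp: le_mult_right)
qed

lemma extend_below_finite:
  assumes "finite L" and "z \<in> carrier M"
    and "\<And>p n. (p, n) \<in> L \<Longrightarrow> prime_element M p"
    and "\<And>y. y \<in> Y \<Longrightarrow> y \<in> carrier M \<and> z \<preceq> y"
    and "\<And>p n y. (p, n) \<in> L \<Longrightarrow> y \<in> Y \<Longrightarrow> p [^] (n::nat) \<preceq> y"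
  shows "\<exists>z'\<in>carrier M. z \<preceq> z' \<and> (\<forall>(p, n)\<in>L. p [^] n \<preceq> z') \<and> (\<forall>y\<in>Y. z' \<preceq> y)"
  using assms
proof (induction rule: finite_induct)
  case empty
  then show ?case using le_refl by blast
next
  case (insert pn L)
  obtain p n where pn: "pn = (p, n)" by (cases pn)
  have pr: "prime_element M p" using insert.prems(2) pn by blast
  have "\<exists>z'\<in>carrier M. z \<preceq> z' \<and> (\<forall>(q, m)\<in>L. q [^] m \<preceq> z') \<and> (\<forall>y\<in>Y. z' \<preceq> y)"
    by (rule insert.IH) (use insert.prems in blast)+
  then obtain z1 where z1: "z1 \<in> carrier M" "z \<preceq> z1" "\<forall>(q, m)\<in>L. q [^] m \<preceq> z1" "\<forall>y\<in>Y. z1 \<preceq> y"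
    by blast
  have "\<exists>z'\<in>carrier M. z1 \<preceq> z' \<and> p [^] n \<preceq> z' \<and> (\<forall>y\<in>Y. z' \<preceq> y)"
    by (rule extend_below[OF pr z1(1)]) (use insert.prems(3,4) z1(4) pn in blast)
  then obtain z2 where z2: "z2 \<in> carrier M" "z1 \<preceq> z2" "p [^] n \<preceq> z2" "\<forall>y\<in>Y. z2 \<preceq> y"
    by blast
  have "q [^] m \<preceq> z2" if qm: "(q, m) \<in> L" for q m
  proof -
    have "q [^] m \<in> carrier M" using insert.prems(2)[of q m] qm by (simp add: prime_closed)
    then show ?thesis using le_trans[OF _ _ z2(2)] z1(3) qm by blast
  qed
  moreover have "z \<preceq> z2" using le_trans[OF insert.prems(1) z1(2) z2(2)] .
  ultimately show ?case using z2 pn by (intro bexI[of _ z2]) auto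
qed

section \<open>Cancellation of primes\<close>

text \<open>
  Refinement of \<open>a + p = b + p\<close> gives \<open>a = c + s\<close>, \<open>b = c + t\<close> and \<open>p = t + u = s + u\<close>.  As \<open>p\<close> is
  prime, it lies below \<open>u\<close>, or else below both \<open>s\<close> and \<open>t\<close>.  If \<open>u = p + w\<close>, then \<open>p\<close>, and with it
  \<open>a\<close> and \<open>b\<close>, absorbs \<open>t + w\<close> and \<open>s + w\<close>, so \<open>a = a + (t + w) = b + (s + w) = b\<close>.  If
  \<open>s = p + s'\<close> and \<open>t = p + t'\<close>, then \<open>p\<close> absorbs \<open>s' + u\<close> and \<open>t' + u\<close>, and
  \<open>a = c + p + s' = c + p + (t' + u) + s' = c + p + (s' + u) + t' = c + p + t' = b\<close>.
\<close>

lemma prime_cancel: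
  assumes p: "prime_element M p" and [simp]: "a \<in> carrier M" "b \<in> carrier M"
    and eq: "a \<otimes> p = b \<otimes> p" and pa: "p \<preceq> a" and pb: "p \<preceq> b"
  shows "a = b"
proof -
  have pc [simp]: "p \<in> carrier M" using p by (rule prime_closed)
  obtain c s t u where z [simp]: "c \<in> carrier M" "s \<in> carrier M" "t \<in> carrier M" "u \<in> carrier M"
    and a: "a = c \<otimes> s" and pt: "p = t \<otimes> u" and b: "b = c \<otimes> t" and ps: "p = s \<otimes> u"
    using refinement[OF _ pc _ pc eq] by auto
  show ?thesis
  proof (cases "p \<preceq> u")
    case True
    then obtain w where w [simp]: "w \<in> carrier M" and u: "u = p \<otimes> w" by (rule leE)
    have pt': "p \<otimes> (t \<otimes> w) = p"
    proof -
      have "p \<otimes> (t \<otimes> w) = t \<otimes> u" unfolding u by (simp add: m_ac)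
      then show ?thesis using pt by metis
    qed
    have ps': "p \<otimes> (s \<otimes> w) = p"
    proof -
      have "p \<otimes> (s \<otimes> w) = s \<otimes> u" unfolding u by (simp add: m_ac)
      then show ?thesis using ps by metis
    qed
    \<comment> \<open>Whatever \<open>p\<close> absorbs is absorbed by everything above \<open>p\<close>, in particular by \<open>a\<close> and \<open>b\<close>.\<close>
    have absorb: "x \<otimes> e = x" if "p \<preceq> x" "p \<otimes> e = p" "e \<in> carrier M" for x e
    proof -
      obtain x' where x': "x' \<in> carrier M" "x = p \<otimes> x'" using \<open>p \<preceq> x\<close> by (rule leE)
      have "x \<otimes> e = p \<otimes> e \<otimes> x'" unfolding x'(2) using x'(1) that(3) by (simp add: m_ac)
      then show ?thesis unfolding that(2) x'(2) .
    qed
    have "a = a \<otimes> (t \<otimes> w)" using absorb[OF pa pt'] by simp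
    also have "\<dots> = b \<otimes> (s \<otimes> w)" unfolding a b by (simp add: m_ac)
    also have "\<dots> = b" using absorb[OF pb ps'] by simp
    finally show ?thesis .
  next
    case False
    have "p \<preceq> s \<otimes> u" "p \<preceq> t \<otimes> u" using ps pt le_refl[OF pc] by auto
    then have "p \<preceq> s" "p \<preceq> t" using False primeD[OF p, of _ u] by auto
    then obtain s' t' where [simp]: "s' \<in> carrier M" "t' \<in> carrier M"
      and s: "s = p \<otimes> s'" and t: "t = p \<otimes> t'" by (auto elim!: leE)
    have ps': "p \<otimes> (s' \<otimes> u) = p"
    proof -
      have "p \<otimes> (s' \<otimes> u) = s \<otimes> u" unfolding s by (simp add: m_ac)
      then show ?thesis using ps by metis
    qed
    have pt': "p \<otimes> (t' \<otimes> u) = p"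
    proof -
      have "p \<otimes> (t' \<otimes> u) = t \<otimes> u" unfolding t by (simp add: m_ac)
      then show ?thesis using pt by metis
    qed
    have "a = c \<otimes> (p \<otimes> (t' \<otimes> u)) \<otimes> s'" unfolding pt' a s by (simp add: m_ac)
    also have "\<dots> = c \<otimes> (p \<otimes> (s' \<otimes> u)) \<otimes> t'" by (simp add: m_ac)
    also have "\<dots> = b" unfolding ps' b t by (simp add: m_ac)
    finally show ?thesis .
  qed
qed

lemma prime_sum_cancel:
  assumes "c \<in> prime_sums M" and "a \<in> carrier M" "b \<in> carrier M"
    and "a \<otimes> c = b \<otimes> c" "c \<preceq> a" "c \<preceq> b"
  shows "a = b"
  using assms
proof (induction rule: prime_sums.induct)
  case one
  then show ?case by simp
next
  case (mult p c)
  have c [simp]: "p \<in> carrier M" "c \<in> carrier M" "a \<in> carrier M" "b \<in> carrier M"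
    using mult.hyps mult.prems by (auto intro: prime_closed prime_sums_closed)
  have pc: "p \<preceq> x \<and> c \<preceq> x" if "p \<otimes> c \<preceq> x" for x
    using that le_trans[OF _ le_mult_right[of p c] that] le_trans[OF _ le_mult_left[of p c] that]
    by simp
  have le: "p \<preceq> x \<otimes> c" if "p \<preceq> x" "x \<in> carrier M" for x
    using le_trans[OF _ that(1) le_mult_right[of x c]] that(2) by simp
  have "a \<otimes> c \<otimes> p = b \<otimes> c \<otimes> p" using mult.prems(3) by (simp add: m_ac)
  then have "a \<otimes> c = b \<otimes> c"
    using prime_cancel[OF mult.hyps(1), of "a \<otimes> c" "b \<otimes> c"] le pc mult.prems(4,5) by auto
  then show ?case using mult.IH pc mult.prems(4,5) by auto
qed

end

section \<open>Primely generated refinement monoids\<close>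

locale primely_generated = refinement_monoid +
  assumes prime_sum: "x \<in> carrier M \<Longrightarrow> x \<in> prime_sums M"
begin

lemma le_if_prime_powers:
  assumes "x \<in> carrier M" "y \<in> carrier M"
    and "\<And>p n. prime_element M p \<Longrightarrow> p [^] (n::nat) \<preceq> x \<Longrightarrow> p [^] n \<preceq> y"
  shows "x \<preceq> y"
  using prime_sums_finite_test[OF prime_sum[OF assms(1)]] assms(2,3) by blast

lemma unperforated: "unperforated M"
  unfolding unperforated_def
proof (intro allI ballI impI, elim conjE)
  fix m :: nat and x y
  assume xy: "x \<in> carrier M" "y \<in> carrier M" and m: "m \<ge> 1" and le: "x [^] m \<preceq> y [^] m"
  show "x \<preceq> y"
  proof (rule le_if_prime_powers[OF xy])
    fix p and n :: nat
    assume p: "prime_element M p" and px: "p [^] n \<preceq> x"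
    have pc: "p \<in> carrier M" using p by (rule prime_closed)
    have "p [^] (n * m) \<preceq> x [^] m" using pow_mono[OF _ px, of m] pc by (simp add: nat_pow_pow)
    then have "p [^] (n * m) \<preceq> y [^] m" using le_trans[OF _ _ le] pc by blast
    then show "p [^] n \<preceq> y" by (rule prime_root_le[OF p xy(2) m])
  qed
qed

lemma separative: "separative M"
  unfolding separative_def
proof (intro ballI impI, elim conjE)
  fix x y
  assume xy: "x \<in> carrier M" "y \<in> carrier M" and eq: "x \<otimes> x = y \<otimes> y" "y \<otimes> y = x \<otimes> y"
  have "x [^] (2::nat) \<preceq> y [^] (2::nat)" using eq xy by (simp add: numeral_2_eq_2 le_refl)
  then have "x \<preceq> y"
    using unperforated xy unfolding unperforated_def by (meson one_le_numeral)
  moreover have "x \<otimes> x = y \<otimes> x" using eq xy by (simp add: m_comm)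
  ultimately show "x = y" using prime_sum_cancel[OF prime_sum] xy le_refl by blast
qed

lemma riesz_interpolation: "riesz_interpolation M"
  unfolding riesz_interpolation_def
proof (intro ballI impI, elim conjE)
  fix x1 x2 y1 y2
  assume x: "x1 \<in> carrier M" "x2 \<in> carrier M" and y: "y1 \<in> carrier M" "y2 \<in> carrier M"
    and le: "x1 \<preceq> y1" "x1 \<preceq> y2" "x2 \<preceq> y1" "x2 \<preceq> y2"
  obtain L :: "('a \<times> nat) set" where L: "finite L" "\<forall>(p, n)\<in>L. prime_element M p \<and> p [^] n \<preceq> x2"
    "\<forall>z\<in>carrier M. (\<forall>(p, n)\<in>L. p [^] n \<preceq> z) \<longrightarrow> x2 \<preceq> z"
    using prime_sums_finite_test[OF prime_sum[OF x(2)]] by blast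
  have "\<exists>z\<in>carrier M. x1 \<preceq> z \<and> (\<forall>(p, n)\<in>L. p [^] n \<preceq> z) \<and> (\<forall>y\<in>{y1, y2}. z \<preceq> y)"
  proof (rule extend_below_finite[OF L(1) x(1)])
    show "prime_element M p" if "(p, n) \<in> L" for p n using L(2) that by blast
    show "y \<in> carrier M \<and> x1 \<preceq> y" if "y \<in> {y1, y2}" for y using that y le by blast
    show "p [^] n \<preceq> y" if "(p, n) \<in> L" "y \<in> {y1, y2}" for p n y
    proof -
      have p: "p [^] n \<in> carrier M" "p [^] n \<preceq> x2" using L(2) that(1) prime_closed by fastforce+
      show ?thesis using le_trans[OF p] that(2) le by blast
    qed
  qed
  then show "\<exists>z\<in>carrier M. x1 \<preceq> z \<and> x2 \<preceq> z \<and> z \<preceq> y1 \<and> z \<preceq> y2"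
    using L(3) by blast
qed

end

section \<open>Finitely generated refinement monoids\<close>

lemma nat_seq_mono_subseq:
  fixes f :: "nat \<Rightarrow> nat"
  obtains g :: "nat \<Rightarrow> nat" where "strict_mono g" "mono (\<lambda>n. f (g n))"
proof -
  obtain g where g: "strict_mono g" "monoseq (\<lambda>n. f (g n))" using seq_monosub[of f] by blast
  show ?thesis
  proof (cases "incseq (\<lambda>n. f (g n))")
    case True
    then show ?thesis using that g(1) by blast
  next
    case False
    then have dec: "f (g n) \<le> f (g m)" if "m \<le> n" for m n
      using g(2) that unfolding monoseq_iff decseq_def by blast
    obtain N where N: "\<And>n. f (g N) \<le> f (g n)"
      using ex_has_least_nat[of "\<lambda>_. True" _ "\<lambda>n. f (g n)"] by blast
    show ?thesis
    proof (rule that[of "\<lambda>n. g (N + n)"])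
      show "strict_mono (\<lambda>n. g (N + n))" using g(1) by (simp add: strict_mono_def)
      show "mono (\<lambda>n. f (g (N + n)))"
      proof (rule monoI)
        fix m n
        show "f (g (N + m)) \<le> f (g (N + n))"
          using dec[of N "N + m"] N[of "N + n"] by simp
      qed
    qed
  qed
qed

text \<open>
  Dickson's lemma for sequences: pass to a monotone subsequence in one coordinate after the other.
\<close>

lemma dickson_subseq:
  fixes f :: "nat \<Rightarrow> 's \<Rightarrow> nat"
  assumes "finite S"
  shows "\<exists>g :: nat \<Rightarrow> nat. strict_mono g \<and> (\<forall>s\<in>S. mono (\<lambda>n. f (g n) s))"
  using assms
proof (induction rule: finite_induct)
  case empty
  show ?case by (rule exI[of _ id]) (simp add: strict_mono_def)
next
  case (insert s S)
  obtain g :: "nat \<Rightarrow> nat" where g: "strict_mono g" "\<forall>t\<in>S. mono (\<lambda>n. f (g n) t)"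
    using insert.IH by blast
  obtain h :: "nat \<Rightarrow> nat" where h: "strict_mono h" "mono (\<lambda>n. f (g (h n)) s)"
    by (rule nat_seq_mono_subseq[of "\<lambda>n. f (g n) s"])
  have "strict_mono (\<lambda>n. g (h n))" using g(1) h(1) by (simp add: strict_mono_def)
  moreover have "mono (\<lambda>n. f (g (h n)) t)" if "t \<in> S" for t
    using g(2) that strict_mono_mono[OF h(1)] by (simp add: mono_def)
  ultimately show ?case using h(2) by (intro exI[of _ "\<lambda>n. g (h n)"]) simp
qed

context comm_monoid
begin

lemma generators_span:
  assumes S: "finite S" "S \<subseteq> carrier G"
    and gen: "\<And>H. submonoid H G \<Longrightarrow> S \<subseteq> H \<Longrightarrow> H = carrier G"
    and x: "x \<in> carrier G"
  shows "\<exists>f :: 'a \<Rightarrow> nat. x = finprod G (\<lambda>s. s [^] f s) S"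
proof -
  define F where "F f = finprod G (\<lambda>s. s [^] f s) S" for f :: "'a \<Rightarrow> nat"
  have pow: "(\<lambda>s. s [^] f s) \<in> S \<rightarrow> carrier G" for f :: "'a \<Rightarrow> nat" using S(2) by auto
  have "submonoid (range F) G"
  proof
    show "range F \<subseteq> carrier G" unfolding F_def using pow by (auto intro: finprod_closed)
    show "x \<otimes> y \<in> range F" if xy: "x \<in> range F" "y \<in> range F" for x y
    proof -
      obtain f g where fg: "x = F f" "y = F g" using xy by blast
      have "x \<otimes> y = finprod G (\<lambda>s. s [^] f s \<otimes> s [^] g s) S"
        unfolding fg F_def using finprod_multf[OF pow pow] by simp
      also have "\<dots> = F (\<lambda>s. f s + g s)"
        unfolding F_def using S(2) by (intro finprod_cong') (auto simp: nat_pow_mult)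
      finally show ?thesis by blast
    qed
    have "\<one> = F (\<lambda>_. 0)" unfolding F_def by (simp add: finprod_one_eqI)
    then show "\<one> \<in> range F" by blast
  qed
  moreover have "S \<subseteq> range F"
  proof
    fix t assume t: "t \<in> S"
    have "F (\<lambda>s. if s = t then 1 else 0) = finprod G (\<lambda>s. if t = s then s else \<one>) S"
      unfolding F_def using S(2) by (intro finprod_cong') auto
    also have "\<dots> = t" using finprod_singleton[OF t S(1), of "\<lambda>s. s"] S(2) by auto
    finally show "t \<in> range F" by (metis rangeI)
  qed
  ultimately show ?thesis using gen x unfolding F_def by blast
qed

lemma finprod_pow_mono:
  assumes "S \<subseteq> carrier G" "\<And>s. s \<in> S \<Longrightarrow> f s \<le> (g s :: nat)"
  shows "finprod G (\<lambda>s. s [^] f s) S \<preceq> finprod G (\<lambda>s. s [^] g s) S"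
proof (rule leI)
  have pow: "(\<lambda>s. s [^] h s) \<in> S \<rightarrow> carrier G" for h :: "'a \<Rightarrow> nat" using assms(1) by auto
  show "finprod G (\<lambda>s. s [^] (g s - f s)) S \<in> carrier G" using pow by (rule finprod_closed)
  have "finprod G (\<lambda>s. s [^] f s) S \<otimes> finprod G (\<lambda>s. s [^] (g s - f s)) S =
      finprod G (\<lambda>s. s [^] f s \<otimes> s [^] (g s - f s)) S"
    using finprod_multf[OF pow pow] by simp
  also have "\<dots> = finprod G (\<lambda>s. s [^] g s) S"
    using assms by (intro finprod_cong') (auto simp: nat_pow_mult)
  finally show "finprod G (\<lambda>s. s [^] f s) S \<otimes> finprod G (\<lambda>s. s [^] (g s - f s)) S =
      finprod G (\<lambda>s. s [^] g s) S" .
qed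

text \<open>
  The exponent vectors of an infinite descending sequence would, by Dickson's lemma, increase along a
  subsequence, so some later member of the sequence would be above an earlier one.
\<close>

lemma finitely_generated_wf:
  assumes "finitely_generated_monoid G"
  shows "wf {(x, y). x \<in> carrier G \<and> y \<in> carrier G \<and> x \<preceq> y \<and> \<not> y \<preceq> x}"
proof (unfold wf_iff_no_infinite_down_chain, rule notI, elim exE)
  fix a assume "\<forall>i. (a (Suc i), a i) \<in> {(x, y). x \<in> carrier G \<and> y \<in> carrier G \<and> x \<preceq> y \<and> \<not> y \<preceq> x}"
  then have a: "a i \<in> carrier G" "a (Suc i) \<preceq> a i" "\<not> a i \<preceq> a (Suc i)" for i by auto
  have down: "a (m + i) \<preceq> a m" for i m
  proof (induction i)
    case 0
    show ?case using le_refl[OF a(1)] by simp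
  next
    case (Suc i)
    show ?case using le_trans[OF a(1) a(2)[of "m + i"] Suc.IH] by simp
  qed
  obtain S where S: "finite S" "S \<subseteq> carrier G"
    and gen: "\<And>H. submonoid H G \<Longrightarrow> S \<subseteq> H \<Longrightarrow> H = carrier G"
    using assms unfolding finitely_generated_monoid_def by auto
  have "\<forall>i. \<exists>f :: 'a \<Rightarrow> nat. a i = finprod G (\<lambda>s. s [^] f s) S"
    using generators_span[OF S gen a(1)] by blast
  from choice[OF this] obtain f :: "nat \<Rightarrow> 'a \<Rightarrow> nat"
    where f: "\<And>i. a i = finprod G (\<lambda>s. s [^] f i s) S" by (elim exE) simp
  obtain g :: "nat \<Rightarrow> nat" where g: "strict_mono g" "\<forall>s\<in>S. mono (\<lambda>n. f (g n) s)"
    using dickson_subseq[OF S(1)] by blast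
  \<comment> \<open>Two members of the subsequence suffice: \<open>a (g 0) \<preceq> a (g 1) \<preceq> a (Suc (g 0))\<close> contradicts strict descent.\<close>
  have "Suc (g 0) \<le> g 1" using g(1) by (simp add: strict_mono_def Suc_leI)
  then have "a (g 1) \<preceq> a (Suc (g 0))" using down[of "Suc (g 0)" "g 1 - Suc (g 0)"] by simp
  moreover have "a (g 0) \<preceq> a (g 1)"
    unfolding f by (rule finprod_pow_mono[OF S(2)]) (use g(2) in \<open>auto simp: mono_def\<close>)
  ultimately have "a (g 0) \<preceq> a (Suc (g 0))" using le_trans[OF a(1)] by blast
  then show False using a(3) by simp
qed

end

text \<open>
  An element that is not prime splits into two strictly smaller elements: the witnesses \<open>a\<close> and \<open>b\<close>
  of its failure to be prime are not above it, so neither are its parts below \<open>a\<close> and below \<open>b\<close>.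
\<close>

lemma finitely_generated_primely_generated:
  fixes M (structure)
  assumes "refinement_monoid M" "finitely_generated_monoid M"
  shows "primely_generated M"
proof -
  interpret refinement_monoid M by fact
  show ?thesis
  proof
    fix x assume "x \<in> carrier M"
    then show "x \<in> prime_sums M"
    proof (induction x rule: wf_induct_rule[OF finitely_generated_wf[OF assms(2)]])
      case (1 x)
      show ?case
      proof (cases "prime_element M x")
        case True
        then show ?thesis by (rule prime_in_prime_sums)
      next
        case False
        then obtain a b where ab: "a \<in> carrier M" "b \<in> carrier M" "x \<preceq> a \<otimes> b" "\<not> x \<preceq> a" "\<not> x \<preceq> b"
          using 1(2) unfolding prime_element_def by blast
        obtain w where w: "w \<in> carrier M" "a \<otimes> b = x \<otimes> w" using ab(3) by (rule leE)
        obtain c d e f where z [simp]: "c \<in> carrier M" "d \<in> carrier M" "e \<in> carrier M" "f \<in> carrier M"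
          and eq: "x = c \<otimes> d" "a = c \<otimes> e" "b = d \<otimes> f"
          using refinement[OF 1(2) w(1) ab(1,2) w(2)[symmetric]] by blast
        have cd: "c \<preceq> x" "d \<preceq> x" unfolding eq(1) by (simp_all add: le_mult_left le_mult_right)
        have "\<not> x \<preceq> c" using ab(4) le_trans[OF 1(2) _ le_mult_right[of c e]] eq(2) by auto
        moreover have "\<not> x \<preceq> d" using ab(5) le_trans[OF 1(2) _ le_mult_right[of d f]] eq(3) by auto
        ultimately have "c \<in> prime_sums M" "d \<in> prime_sums M"
          using 1(1)[of c] 1(1)[of d] 1(2) cd z(1,2) by blast+
        then show ?thesis unfolding eq(1) by (rule prime_sums_mult)
      qed
    qed
  qed
qed

section \<open>Passage to inductive limits\<close>

context
  fixes I :: "'i set" and r and A :: "'i \<Rightarrow> 'b monoid" and \<phi> and M :: "'a monoid" and \<psi>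
  assumes lim: "inductive_limit I r A \<phi> M \<psi>"
begin

interpretation inductive_system I r A \<phi>
  using lim by (simp add: inductive_limit_def)

lemma limit_psi_hom: "i \<in> I \<Longrightarrow> \<psi> i \<in> mon_hom (A i) M"
  using lim coconeD(2)[of I r A \<phi> M \<psi>] by (simp add: inductive_limit_def)

lemma limit_psi_phi: "(i, j) \<in> r \<Longrightarrow> x \<in> carrier (A i) \<Longrightarrow> \<psi> j (\<phi> i j x) = \<psi> i x"
  using lim coconeD(3)[of I r A \<phi> M \<psi>] by (simp add: inductive_limit_def)

lemma limit_finite_lift:
  assumes "finite X" "X \<subseteq> carrier M"
  shows "\<exists>i\<in>I. X \<subseteq> \<psi> i ` carrier (A i)"
  using assms
proof (induction rule: finite_induct)
  case empty
  then show ?case using nonempty by blast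
next
  case (insert x X)
  obtain i where i: "i \<in> I" "X \<subseteq> \<psi> i ` carrier (A i)" using insert.IH insert.prems by auto
  obtain j u where j: "j \<in> I" "u \<in> carrier (A j)" "x = \<psi> j u"
    using inductive_limit_concrete(1)[OF lim] insert.prems by blast
  obtain k where k: "k \<in> I" "(i, k) \<in> r" "(j, k) \<in> r" using directed[OF i(1) j(1)] by blast
  have "\<psi> l v \<in> \<psi> k ` carrier (A k)" if "(l, k) \<in> r" "v \<in> carrier (A l)" for l v
    using limit_psi_phi[OF that] phi_closed[OF that] by (metis imageI)
  then have "insert x X \<subseteq> \<psi> k ` carrier (A k)" using i(2) j(2,3) k(2,3) by auto
  then show ?case using k(1) by blast
qed

lemma limit_eq_lift:
  assumes "i \<in> I" "x \<in> carrier (A i)" "y \<in> carrier (A i)" "\<psi> i x = \<psi> i y"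
  shows "\<exists>j. (i, j) \<in> r \<and> \<phi> i j x = \<phi> i j y"
  using inductive_limit_concrete(2)[OF lim assms(1,1,2,3,4)] by auto

text \<open>
  The inequality holds in the limit by virtue of some difference \<open>w\<close>.  Both \<open>w\<close> and the equation that
  it satisfies appear at a later stage.
\<close>

lemma limit_le_lift:
  assumes i: "i \<in> I" and x: "x \<in> carrier (A i)" and y: "y \<in> carrier (A i)"
    and le: "alg_le M (\<psi> i x) (\<psi> i y)"
  shows "\<exists>j. (i, j) \<in> r \<and> alg_le (A j) (\<phi> i j x) (\<phi> i j y)"
proof -
  obtain w where w: "w \<in> carrier M" "\<psi> i x \<otimes>\<^bsub>M\<^esub> w = \<psi> i y" using le by (auto simp: alg_le_def)
  obtain l v where l: "l \<in> I" "v \<in> carrier (A l)" "w = \<psi> l v"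
    using inductive_limit_concrete(1)[OF lim w(1)] by blast
  obtain k where k: "k \<in> I" "(i, k) \<in> r" "(l, k) \<in> r" using directed[OF i l(1)] by blast
  interpret Ak: comm_monoid "A k" using monoids k(1) .
  have c: "\<phi> i k x \<in> carrier (A k)" "\<phi> i k y \<in> carrier (A k)" "\<phi> l k v \<in> carrier (A k)"
    using phi_closed k x y l by auto
  have "\<psi> k (\<phi> i k x \<otimes>\<^bsub>A k\<^esub> \<phi> l k v) = \<psi> k (\<phi> i k y)"
    using mon_homD(2)[OF limit_psi_hom[OF k(1)] c(1,3)] limit_psi_phi k x y l w(2) by simp
  then obtain j where j: "(k, j) \<in> r" "\<phi> k j (\<phi> i k x \<otimes>\<^bsub>A k\<^esub> \<phi> l k v) = \<phi> k j (\<phi> i k y)"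
    using limit_eq_lift[OF k(1)] c by blast
  have "\<phi> i j x \<otimes>\<^bsub>A j\<^esub> \<phi> k j (\<phi> l k v) = \<phi> i j y"
    using j(2) phi_mult[OF j(1) c(1,3)] trans_comp[OF k(2) j(1)] x y by simp
  then show ?thesis
    using phi_closed[OF j(1) c(3)] r_trans[OF k(2) j(1)] by (auto simp: alg_le_def)
qed

lemma phi_le_mono:
  assumes "(i, j) \<in> r" "(j, k) \<in> r" "x \<in> carrier (A i)" "y \<in> carrier (A i)"
    and "alg_le (A j) (\<phi> i j x) (\<phi> i j y)"
  shows "alg_le (A k) (\<phi> i k x) (\<phi> i k y)"
  using mon_hom_le[OF trans_hom[OF assms(2)] phi_closed[OF assms(1,3)] assms(5)]
    trans_comp[OF assms(1,2)] assms(3,4) by simp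

lemma limit_separative:
  assumes sep: "\<And>i. i \<in> I \<Longrightarrow> separative (A i)"
  shows "separative M"
  unfolding separative_def
proof (intro ballI impI, elim conjE)
  fix x y
  assume "x \<in> carrier M" "y \<in> carrier M"
    and eq: "x \<otimes>\<^bsub>M\<^esub> x = y \<otimes>\<^bsub>M\<^esub> y" "y \<otimes>\<^bsub>M\<^esub> y = x \<otimes>\<^bsub>M\<^esub> y"
  then obtain i u v where i: "i \<in> I" and u: "u \<in> carrier (A i)" "x = \<psi> i u"
    and v: "v \<in> carrier (A i)" "y = \<psi> i v"
    using limit_finite_lift[of "{x, y}"] by auto
  interpret Ai: comm_monoid "A i" using monoids i .
  note hom = mon_homD(2)[OF limit_psi_hom[OF i]]
  obtain j where j: "(i, j) \<in> r" "\<phi> i j (u \<otimes>\<^bsub>A i\<^esub> u) = \<phi> i j (v \<otimes>\<^bsub>A i\<^esub> v)"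
    using limit_eq_lift[OF i, of "u \<otimes>\<^bsub>A i\<^esub> u" "v \<otimes>\<^bsub>A i\<^esub> v"] hom u v eq by auto
  obtain k where k: "(i, k) \<in> r" "\<phi> i k (v \<otimes>\<^bsub>A i\<^esub> v) = \<phi> i k (u \<otimes>\<^bsub>A i\<^esub> v)"
    using limit_eq_lift[OF i, of "v \<otimes>\<^bsub>A i\<^esub> v" "u \<otimes>\<^bsub>A i\<^esub> v"] hom u v eq by auto
  obtain l where l: "l \<in> I" "(j, l) \<in> r" "(k, l) \<in> r" using directed rD j(1) k(1) by metis
  have il: "(i, l) \<in> r" using r_trans j(1) l(2) by blast
  have "\<phi> i l (u \<otimes>\<^bsub>A i\<^esub> u) = \<phi> i l (v \<otimes>\<^bsub>A i\<^esub> v)"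
    using arg_cong[OF j(2), of "\<phi> j l"] trans_comp[OF j(1) l(2)] u v by simp
  moreover have "\<phi> i l (v \<otimes>\<^bsub>A i\<^esub> v) = \<phi> i l (u \<otimes>\<^bsub>A i\<^esub> v)"
    using arg_cong[OF k(2), of "\<phi> k l"] trans_comp[OF k(1) l(3)] u v by simp
  ultimately have "\<phi> i l u = \<phi> i l v"
    using sep[OF l(1)] phi_mult[OF il] phi_closed[OF il] u v unfolding separative_def by simp
  then show "x = y" using limit_psi_phi[OF il] u v by metis
qed

lemma limit_unperforated:
  assumes unp: "\<And>i. i \<in> I \<Longrightarrow> unperforated (A i)"
  shows "unperforated M"
  unfolding unperforated_def
proof (intro allI ballI impI, elim conjE)
  fix m :: nat and x y
  assume m: "m \<ge> 1" and "x \<in> carrier M" "y \<in> carrier M"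
    and le: "alg_le M (x [^]\<^bsub>M\<^esub> m) (y [^]\<^bsub>M\<^esub> m)"
  then obtain i u v where i: "i \<in> I" and u: "u \<in> carrier (A i)" "x = \<psi> i u"
    and v: "v \<in> carrier (A i)" "y = \<psi> i v"
    using limit_finite_lift[of "{x, y}"] by auto
  have mon: "monoid (A j)" if "j \<in> I" for j using monoids[OF that] by (rule comm_monoid.axioms(1))
  interpret M: comm_monoid M using lim coconeD(1)[of I r A \<phi> M \<psi>] by (simp add: inductive_limit_def)
  interpret Ai: comm_monoid "A i" using monoids i .
  have "alg_le M (\<psi> i (u [^]\<^bsub>A i\<^esub> m)) (\<psi> i (v [^]\<^bsub>A i\<^esub> m))"
    using le u v mon_hom_pow[OF mon[OF i] M.monoid_axioms limit_psi_hom[OF i]] by simp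
  then obtain j where ij: "(i, j) \<in> r"
    and "alg_le (A j) (\<phi> i j (u [^]\<^bsub>A i\<^esub> m)) (\<phi> i j (v [^]\<^bsub>A i\<^esub> m))"
    using limit_le_lift[OF i] u v by blast
  moreover have j: "j \<in> I" using rD ij by blast
  ultimately have le': "alg_le (A j) (\<phi> i j u) (\<phi> i j v)"
    using mon_hom_pow[OF mon[OF i] mon[OF j] trans_hom[OF ij]] unp[OF j] m u v phi_closed[OF ij]
    unfolding unperforated_def by simp
  show "alg_le M x y"
    using mon_hom_le[OF limit_psi_hom[OF j] phi_closed[OF ij u(1)] le'] limit_psi_phi[OF ij] u v by simp
qed

lemma limit_riesz_interpolation:
  assumes riesz: "\<And>i. i \<in> I \<Longrightarrow> riesz_interpolation (A i)"
  shows "riesz_interpolation M"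
  unfolding riesz_interpolation_def
proof (intro ballI impI, elim conjE)
  fix x1 x2 y1 y2
  assume "x1 \<in> carrier M" "x2 \<in> carrier M" "y1 \<in> carrier M" "y2 \<in> carrier M"
    and le: "alg_le M x1 y1" "alg_le M x1 y2" "alg_le M x2 y1" "alg_le M x2 y2"
  then obtain i where i: "i \<in> I" and "{x1, x2, y1, y2} \<subseteq> \<psi> i ` carrier (A i)"
    using limit_finite_lift[of "{x1, x2, y1, y2}"] by auto
  then obtain u1 u2 v1 v2 where c: "u1 \<in> carrier (A i)" "u2 \<in> carrier (A i)"
    "v1 \<in> carrier (A i)" "v2 \<in> carrier (A i)"
    and eq: "x1 = \<psi> i u1" "x2 = \<psi> i u2" "y1 = \<psi> i v1" "y2 = \<psi> i v2" by auto
  obtain a where a: "(i, a) \<in> r" "alg_le (A a) (\<phi> i a u1) (\<phi> i a v1)"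
    using limit_le_lift[OF i c(1,3)] le eq by blast
  obtain b where b: "(i, b) \<in> r" "alg_le (A b) (\<phi> i b u1) (\<phi> i b v2)"
    using limit_le_lift[OF i c(1,4)] le eq by blast
  obtain d where d: "(i, d) \<in> r" "alg_le (A d) (\<phi> i d u2) (\<phi> i d v1)"
    using limit_le_lift[OF i c(2,3)] le eq by blast
  obtain e where e: "(i, e) \<in> r" "alg_le (A e) (\<phi> i e u2) (\<phi> i e v2)"
    using limit_le_lift[OF i c(2,4)] le eq by blast
  obtain f g where f: "(a, f) \<in> r" "(b, f) \<in> r" and g: "(d, g) \<in> r" "(e, g) \<in> r"
    using directed rD a(1) b(1) d(1) e(1) by metis
  obtain k where k: "k \<in> I" "(f, k) \<in> r" "(g, k) \<in> r" using directed rD f(1) g(1) by metis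
  have up: "(a, k) \<in> r" "(b, k) \<in> r" "(d, k) \<in> r" "(e, k) \<in> r" using f g k r_trans by blast+
  have ik: "(i, k) \<in> r" using r_trans a(1) up(1) by blast
  have "alg_le (A k) (\<phi> i k u1) (\<phi> i k v1)" "alg_le (A k) (\<phi> i k u1) (\<phi> i k v2)"
    "alg_le (A k) (\<phi> i k u2) (\<phi> i k v1)" "alg_le (A k) (\<phi> i k u2) (\<phi> i k v2)"
    using phi_le_mono a b d e up c by blast+
  moreover note cl = phi_closed[OF ik c(1)] phi_closed[OF ik c(2)]
    phi_closed[OF ik c(3)] phi_closed[OF ik c(4)]
  ultimately obtain z where z: "z \<in> carrier (A k)"
    "alg_le (A k) (\<phi> i k u1) z" "alg_le (A k) (\<phi> i k u2) z"
    "alg_le (A k) z (\<phi> i k v1)" "alg_le (A k) z (\<phi> i k v2)"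
    using riesz[OF k(1)] unfolding riesz_interpolation_def by blast
  note hom = limit_psi_hom[OF k(1)]
  have "alg_le M x1 (\<psi> k z)" "alg_le M x2 (\<psi> k z)" "alg_le M (\<psi> k z) y1" "alg_le M (\<psi> k z) y2"
    using mon_hom_le[OF hom cl(1) z(2)] mon_hom_le[OF hom cl(2) z(3)]
      mon_hom_le[OF hom z(1) z(4)] mon_hom_le[OF hom z(1) z(5)] limit_psi_phi[OF ik] c eq by simp_all
  then show "\<exists>z\<in>carrier M. alg_le M x1 z \<and> alg_le M x2 z \<and> alg_le M z y1 \<and> alg_le M z y2"
    using mon_homD(1)[OF hom z(1)] by blast
qed

end

theorem theorem2p3:
  fixes M :: "'a monoid"
  assumes "tame_refinement_monoid TYPE('i) TYPE('b) M"
  shows "separative M \<and> unperforated M \<and> riesz_interpolation M"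
proof -
  obtain I :: "'i set" and r and A :: "'i \<Rightarrow> 'b monoid" and \<phi> \<psi>
    where lim: "inductive_limit I r A \<phi> M \<psi>"
      and A: "\<And>i. i \<in> I \<Longrightarrow> refinement_monoid (A i) \<and> finitely_generated_monoid (A i)"
    using assms unfolding tame_refinement_monoid_def by blast
  have gen: "primely_generated (A i)" if "i \<in> I" for i
    using finitely_generated_primely_generated A[OF that] by blast
  show ?thesis
    using limit_separative[OF lim primely_generated.separative[OF gen]]
      limit_unperforated[OF lim primely_generated.unperforated[OF gen]]
      limit_riesz_interpolation[OF lim primely_generated.riesz_interpolation[OF gen]] by blast
qed

end
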